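(* Let $k\geq\ell\geq 1$ and $n\geq 1$ be integers. Then $G(k,n)$ has an $\ell$-decomposition if and only if there are $k-\ell$ mutually invertible $\ell$-dimensional Latin cubes $L_1,\dots,L_{k-\ell}$ of order $n$.
   Context: $[n]:=\{1,2,\dots,n\}$. $G(k,n)$ is the complete $k$-partite graph with $n$ vertices in each colour class: its vertex set is $[k]\times[n]$, and $(c,u)$ is adjacent to $(d,v)$ if and only if $c\neq d$. $K_m$ is the complete graph on $m$ vertices. An $\ell$-decomposition of $G(k,n)$ is a set $X$ of copies of $K_k$ in $G(k,n)$ (i.e. subgraphs isomorphic to $K_k$) such that each copy of $K_\ell$ in $G(k,n)$ is a subgraph of exactly one copy of $K_k$ in $X$. A $d$-dimensional Latin cube of order $n$ is a function $L:[n]^d\to[n]$ such that for all $i\in[d]$ and all $x_1,\dots,x_{i-1},x_{i+1},\dots,x_d\in[n]$, $\{L(x_1,\dots,x_{i-1},j,x_{i+1},\dots,x_d):j\in[n]\}=[n]$. A $k$-tuple $t=(t_1,\dots,t_k)\in[n]^k$ is viewed as a function $[k]\to[n]$ with $t(i)=t_i$. A set $X$ of $k$-tuples in $[n]^k$ is $\ell$-extendable if for all indices $s_1<s_2<\cdots<s_\ell$ in $[k]$ and every $(x_1,\dots,x_\ell)\in[n]^\ell$ there exists a unique $t\in X$ such that $t(s_i)=x_i$ for all $i\in[\ell]$. A list $L_1,\dots,L_m$ ($m\ge 0$) of $\ell$-dimensional Latin cubes of order $n$ is mutually invertible if the set of $(m+\ell)$-tuples $\{(L_1(x_1,\dots,x_\ell),\dots,L_m(x_1,\dots,x_\ell),x_1,\dots,x_\ell):(x_1,\dots,x_\ell)\in[n]^\ell\}$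 is $\ell$-extendable. *)

theory Defs
  imports "Graph_Theory.Kuratowski" "HOL-Library.FuncSet"
begin

text \<open>
  Undirected simple graphs are the library's symmetric, loop-free digraphs without parallel arcs
  (locale \<^locale>\<open>graph\<close>); an edge is the pair of its two orientations. The library predicate
  \<^const>\<open>complete_digraph\<close> \<open>m H\<close> says that \<open>H\<close> is such a graph, isomorphic to $K_m$.
\<close>

definition complete_partite :: "nat \<Rightarrow> nat \<Rightarrow> (nat \<times> nat) pair_pre_digraph" where
  "complete_partite k n =
    \<lparr> pverts = {1..k} \<times> {1..n},
      parcs = {((c, u), (d, v)) | c u d v.
        (c, u) \<in> {1..k} \<times> {1..n} \<and> (d, v) \<in> {1..k} \<times> {1..n} \<and> c \<noteq> d} \<rparr>"

lemma graph_complete_partite: "graph (with_proj (complete_partite k n))"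
proof -
  let ?G = "complete_partite k n"
  have "parcs ?G \<subseteq> ({1..k} \<times> {1..n}) \<times> ({1..k} \<times> {1..n})"
    by (auto simp: complete_partite_def)
  then have "finite (parcs ?G)"
    by (rule finite_subset) simp
  then show ?thesis
    by unfold_locales
      (auto simp: complete_partite_def symmetric_def arc_to_ends_def intro!: symI)
qed

text \<open>
  Because the arcs of a \<^typ>\<open>'a pair_pre_digraph\<close> are pairs of vertices, distinct elements of
  \<open>clique_copies m G\<close> differ in their vertices or edges, so copies are never counted twice.
\<close>

definition clique_copies :: "nat \<Rightarrow> 'a pair_pre_digraph \<Rightarrow> 'a pair_pre_digraph set" where
  "clique_copies m G = {H. subgraph (with_proj H) (with_proj G) \<and> complete_digraph m (with_proj H)}"

definition is_decomposition ::
    "nat \<Rightarrow> nat \<Rightarrow> nat \<Rightarrow> (nat \<times> nat) pair_pre_digraph set \<Rightarrow> bool" where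
  "is_decomposition l k n X \<longleftrightarrow>
    X \<subseteq> clique_copies k (complete_partite k n) \<and>
    (\<forall>H \<in> clique_copies l (complete_partite k n).
      \<exists>!K. K \<in> X \<and> subgraph (with_proj H) (with_proj K))"

text \<open>
  A \<open>k\<close>-tuple in $[n]^k$ is a function on \<open>{1..k}\<close>, extensional so that equality of functions is
  equality of tuples.
\<close>

definition tuples :: "nat \<Rightarrow> nat \<Rightarrow> (nat \<Rightarrow> nat) set" where
  "tuples k n = {1..k} \<rightarrow>\<^sub>E {1..n}"

definition latin_cube :: "nat \<Rightarrow> nat \<Rightarrow> ((nat \<Rightarrow> nat) \<Rightarrow> nat) \<Rightarrow> bool" where
  "latin_cube d n L \<longleftrightarrow>
    L \<in> tuples d n \<rightarrow>\<^sub>E {1..n} \<and>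
    (\<forall>i \<in> {1..d}. \<forall>x \<in> ({1..d} - {i}) \<rightarrow>\<^sub>E {1..n}. {L (x(i := j)) | j. j \<in> {1..n}} = {1..n})"

definition extendable :: "nat \<Rightarrow> nat \<Rightarrow> nat \<Rightarrow> (nat \<Rightarrow> nat) set \<Rightarrow> bool" where
  "extendable l k n X \<longleftrightarrow>
    X \<subseteq> tuples k n \<and>
    (\<forall>s \<in> {1..l} \<rightarrow> {1..k}. strict_mono_on {1..l} s \<longrightarrow>
      (\<forall>x \<in> tuples l n. \<exists>!t. t \<in> X \<and> (\<forall>i \<in> {1..l}. t (s i) = x i)))"

text \<open>
  The tuple $(L_1(x), \dots, L_m(x), x_1, \dots, x_l)$; the list is indexed from \<open>0\<close>, tuples
  from \<open>1\<close>.
\<close>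

definition graph_tuple :: "nat \<Rightarrow> ((nat \<Rightarrow> nat) \<Rightarrow> nat) list \<Rightarrow> (nat \<Rightarrow> nat) \<Rightarrow> (nat \<Rightarrow> nat)" where
  "graph_tuple l Ls x =
    (\<lambda>i \<in> {1..length Ls + l}. if i \<le> length Ls then (Ls ! (i - 1)) x else x (i - length Ls))"

definition mutually_invertible :: "nat \<Rightarrow> nat \<Rightarrow> ((nat \<Rightarrow> nat) \<Rightarrow> nat) list \<Rightarrow> bool" where
  "mutually_invertible l n Ls \<longleftrightarrow>
    extendable l (length Ls + l) n {graph_tuple l Ls x | x. x \<in> tuples l n}"

end

theory Submission
  imports Defs
begin

text \<open>
  Two vertices of the same colour are not adjacent, so a copy of $K_m$ in $G(k,n)$ uses $m$
  different colours and one vertex of each. It is therefore the same thing as a set \<open>S\<close> of \<open>m\<close>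
  colours with a function \<open>S \<rightarrow> [n]\<close> (\<open>clique_copies_complete_partite\<close>). In particular the copies
  of $K_k$ are the \<open>k\<close>-tuples, and one copy is a subgraph of another exactly when its partial
  function is a restriction of the other's (\<open>subgraph_transversal_clique\<close>). Under this
  dictionary an \<open>l\<close>-decomposition is a set \<open>T\<close> of \<open>k\<close>-tuples in which every partial tuple with
  \<open>l\<close> entries extends to exactly one member of \<open>T\<close>. That is \<open>l\<close>-extendability, except that
  there the \<open>l\<close> positions are listed increasingly instead of given as a set
  (\<open>extendable_iff_subsets\<close>).

  It remains to pass between extendable sets and cubes. From cubes to sets this is the definition
  of mutual invertibility. Conversely, in an \<open>l\<close>-extendable set \<open>T\<close> of \<open>k\<close>-tuples the last
  \<open>l\<close> entries can be prescribed freely and determine the tuple. So \<open>T\<close> is the graph of a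
  function of these entries, whose \<open>k - l\<close> coordinates are the cubes. The Latin property of such a
  coordinate says that its value can replace any one of the \<open>l\<close> arguments as the prescribed entry,
  which is extendability at another choice of \<open>l\<close> positions (\<open>cubes_of_extendable\<close>).
\<close>

section \<open>Cliques in complete multipartite graphs\<close>

definition transversal_clique :: "nat set \<Rightarrow> (nat \<Rightarrow> nat) \<Rightarrow> (nat \<times> nat) pair_pre_digraph" where
  "transversal_clique S f =
    \<lparr> pverts = (\<lambda>c. (c, f c)) ` S,
      parcs = {(u, v). u \<in> (\<lambda>c. (c, f c)) ` S \<and> v \<in> (\<lambda>c. (c, f c)) ` S \<and> u \<noteq> v} \<rparr>"

lemma complete_transversal_clique:
  assumes "finite S"
  shows "complete_digraph (card S) (with_proj (transversal_clique S f))"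
  using assms
  by (simp add: complete_digraph_pair_def transversal_clique_def card_image inj_on_def)

lemma wf_transversal_clique: "wf_digraph (with_proj (transversal_clique S f))"
  by unfold_locales (auto simp: transversal_clique_def)

text \<open>
  Containment of vertex sets suffices, because a clique has all edges between its vertices; the
  vertex sets are the graphs of the two functions.
\<close>

lemma subgraph_transversal_clique:
  "subgraph (with_proj (transversal_clique S f)) (with_proj (transversal_clique S' f')) \<longleftrightarrow>
    S \<subseteq> S' \<and> (\<forall>c \<in> S. f' c = f c)"
proof -
  have "subgraph (with_proj (transversal_clique S f)) (with_proj (transversal_clique S' f')) \<longleftrightarrow>
      (\<lambda>c. (c, f c)) ` S \<subseteq> (\<lambda>c. (c, f' c)) ` S'"
    using wf_transversal_clique[of S f] wf_transversal_clique[of S' f']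
    by (auto simp: subgraph_def compatible_def transversal_clique_def)
  also have "\<dots> \<longleftrightarrow> S \<subseteq> S' \<and> (\<forall>c \<in> S. f' c = f c)"
    by auto
  finally show ?thesis .
qed

lemma subgraph_complete_partite:
  assumes "S \<subseteq> {1..k}" and "f \<in> S \<rightarrow>\<^sub>E {1..n}"
  shows "subgraph (with_proj (transversal_clique S f)) (with_proj (complete_partite k n))"
proof -
  interpret G: graph "with_proj (complete_partite k n)"
    by (rule graph_complete_partite)
  have f: "f c \<in> {1..n}" if "c \<in> S" for c
    using assms(2) that by auto
  have "pverts (transversal_clique S f) \<subseteq> pverts (complete_partite k n)"
    using assms(1) f unfolding transversal_clique_def complete_partite_def by fastforce
  moreover have "parcs (transversal_clique S f) \<subseteq> parcs (complete_partite k n)"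
    using assms(1) f unfolding transversal_clique_def complete_partite_def by fastforce
  ultimately show ?thesis
    using wf_transversal_clique[of S f] G.wf_digraph
    by (auto simp: subgraph_def)
qed

text \<open>
  The colour map is injective on a clique, since vertices of equal colour are not adjacent. So the
  vertex set is the graph of a function on the set of its colours.
\<close>

lemma clique_copies_complete_partite:
  "clique_copies m (complete_partite k n) =
    {transversal_clique S f | S f. S \<subseteq> {1..k} \<and> card S = m \<and> f \<in> S \<rightarrow>\<^sub>E {1..n}}"
  (is "?L = ?R")
proof (intro equalityI subsetI)
  fix H assume "H \<in> ?L"
  then have sub: "pverts H \<subseteq> pverts (complete_partite k n)"
      "parcs H \<subseteq> parcs (complete_partite k n)"
    and card: "card (pverts H) = m"
    and arcs: "parcs H = {(u, v). (u, v) \<in> pverts H \<times> pverts H \<and> u \<noteq> v}"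
    by (auto simp: clique_copies_def subgraph_def complete_digraph_pair_def)
  have colours: "inj_on fst (pverts H)"
  proof (rule inj_onI, rule ccontr)
    fix u v assume "u \<in> pverts H" "v \<in> pverts H" "fst u = fst v" "u \<noteq> v"
    then have "(u, v) \<in> parcs (complete_partite k n)"
      using sub(2) arcs by auto
    with \<open>fst u = fst v\<close> show False
      by (auto simp: complete_partite_def)
  qed
  define S where "S = fst ` pverts H"
  define f where "f = restrict (\<lambda>c. snd (the_inv_into (pverts H) fst c)) S"
  have f: "f (fst u) = snd u" if "u \<in> pverts H" for u
    using that colours by (simp add: f_def S_def the_inv_into_f_f)
  have verts: "pverts H = (\<lambda>c. (c, f c)) ` S"
    using f by (force simp: S_def)
  have "H = transversal_clique S f"
    unfolding transversal_clique_def verts[symmetric]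
    by (rule pair_pre_digraph.equality) (use arcs in auto)
  moreover have "S \<subseteq> {1..k}"
    using sub(1) by (auto simp: S_def complete_partite_def)
  moreover have "card S = m"
    using card colours by (simp add: S_def card_image)
  moreover have "f \<in> S \<rightarrow>\<^sub>E {1..n}"
  proof
    fix c assume "c \<in> S"
    then have "(c, f c) \<in> pverts (complete_partite k n)"
      using verts sub(1) by auto
    then show "f c \<in> {1..n}"
      by (simp add: complete_partite_def)
  qed (simp add: f_def)
  ultimately show "H \<in> ?R"
    by blast
next
  fix H assume "H \<in> ?R"
  then obtain S f where H: "H = transversal_clique S f"
    and S: "S \<subseteq> {1..k}" "card S = m" and f: "f \<in> S \<rightarrow>\<^sub>E {1..n}"
    by blast
  have "finite S"
    using S(1) finite_subset by blast
  with S f show "H \<in> ?L"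
    using complete_transversal_clique[of S f] subgraph_complete_partite[of S k f n]
    by (simp add: clique_copies_def H)
qed

lemma clique_copies_full:
  "clique_copies k (complete_partite k n) = transversal_clique {1..k} ` tuples k n"
proof -
  have "S \<subseteq> {1..k} \<and> card S = k \<longleftrightarrow> S = {1..k}" for S :: "nat set"
    using card_subset_eq[of "{1..k}" S] by auto
  then have "clique_copies k (complete_partite k n) =
      {transversal_clique S f | S f. S = {1..k} \<and> f \<in> S \<rightarrow>\<^sub>E {1..n}}"
    by (simp only: clique_copies_complete_partite conj_assoc[symmetric])
  also have "\<dots> = transversal_clique {1..k} ` tuples k n"
    unfolding tuples_def by blast
  finally show ?thesis .
qed

lemma inj_on_transversal_clique: "inj_on (transversal_clique {1..k}) (tuples k n)"
proof (rule inj_onI)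
  fix t t' assume tup: "t \<in> tuples k n" "t' \<in> tuples k n"
    and eq: "transversal_clique {1..k} t = transversal_clique {1..k} t'"
  have "\<forall>c \<in> {1..k}. t' c = t c"
    using subgraph_transversal_clique[of "{1..k}" t "{1..k}" t']
      subgraph_transversal_clique[of "{1..k}" t "{1..k}" t] eq by simp
  then show "t = t'"
    using tup unfolding tuples_def by (intro PiE_ext) auto
qed

section \<open>Decompositions as extendable sets of tuples\<close>

text \<open>
  Each set of \<open>l\<close> positions has exactly one increasing enumeration, so prescribing entries along
  the enumeration is the same as prescribing a function on the set.
\<close>

lemma extendable_iff_subsets:
  "extendable l k n T \<longleftrightarrow>
    T \<subseteq> tuples k n \<and>
    (\<forall>S f. S \<subseteq> {1..k} \<longrightarrow> card S = l \<longrightarrow> f \<in> S \<rightarrow>\<^sub>E {1..n} \<longrightarrow>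
      (\<exists>!t. t \<in> T \<and> (\<forall>c \<in> S. t c = f c)))"
  (is "?L \<longleftrightarrow> ?R")
proof
  assume ext: ?L
  have "\<exists>!t. t \<in> T \<and> (\<forall>c \<in> S. t c = f c)"
    if S: "S \<subseteq> {1..k}" "card S = l" and f: "f \<in> S \<rightarrow>\<^sub>E {1..n}" for S f
  proof -
    have "finite S"
      using S(1) finite_subset by blast
    \<comment> \<open>The increasing enumeration of \<open>S\<close>; the shift is because lists are indexed from \<open>0\<close>.\<close>
    define h where "h i = sorted_list_of_set S ! (i - 1)" for i
    have h: "h ` {1..l} = S"
    proof -
      have "h ` {1..l} = (\<lambda>i. sorted_list_of_set S ! i) ` {..<l}"
        by (simp only: h_def image_Suc_lessThan[symmetric] image_image diff_Suc_1)
      also have "\<dots> = set (sorted_list_of_set S)"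
        using S(2) by (simp add: set_conv_nth image_def lessThan_def conj_commute eq_commute Bex_def)
      also have "\<dots> = S"
        using \<open>finite S\<close> by simp
      finally show ?thesis .
    qed
    have mono: "strict_mono_on {1..l} h"
    proof (rule strict_mono_onI)
      fix i j assume "i \<in> {1..l}" "j \<in> {1..l}" "i < j"
      then show "h i < h j"
        unfolding h_def using S(2)
        by (intro sorted_wrt_nth_less[OF strict_sorted_list_of_set]) auto
    qed
    define x where "x = (\<lambda>i \<in> {1..l}. f (h i))"
    have "x \<in> tuples l n"
      using f h by (auto simp: x_def tuples_def)
    moreover have "h \<in> {1..l} \<rightarrow> {1..k}"
      using h S(1) by auto
    ultimately have "\<exists>!t. t \<in> T \<and> (\<forall>i \<in> {1..l}. t (h i) = x i)"
      using ext mono by (simp add: extendable_def)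
    moreover have "(\<forall>i \<in> {1..l}. t (h i) = x i) \<longleftrightarrow> (\<forall>c \<in> S. t c = f c)" for t
      by (simp add: x_def flip: h)
    ultimately show ?thesis
      by simp
  qed
  with ext show ?R
    by (simp add: extendable_def)
next
  assume sets: ?R
  have "\<exists>!t. t \<in> T \<and> (\<forall>i \<in> {1..l}. t (s i) = x i)"
    if s: "s \<in> {1..l} \<rightarrow> {1..k}" "strict_mono_on {1..l} s" and x: "x \<in> tuples l n" for s x
  proof -
    have inj: "inj_on s {1..l}"
      using s(2) by (rule strict_mono_on_imp_inj_on)
    define f where "f = restrict (\<lambda>c. x (the_inv_into {1..l} s c)) (s ` {1..l})"
    have f: "f (s i) = x i" if "i \<in> {1..l}" for i
      using that inj by (simp add: f_def the_inv_into_f_f)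
    have "f \<in> s ` {1..l} \<rightarrow>\<^sub>E {1..n}"
    proof
      fix c assume "c \<in> s ` {1..l}"
      then show "f c \<in> {1..n}"
        using f x by (auto simp: tuples_def)
    qed (simp add: f_def)
    moreover have "s ` {1..l} \<subseteq> {1..k}" "card (s ` {1..l}) = l"
      using s(1) inj by (auto simp: card_image)
    ultimately have "\<exists>!t. t \<in> T \<and> (\<forall>c \<in> s ` {1..l}. t c = f c)"
      using sets by blast
    moreover have "(\<forall>c \<in> s ` {1..l}. t c = f c) \<longleftrightarrow> (\<forall>i \<in> {1..l}. t (s i) = x i)" for t
      using f by simp
    ultimately show ?thesis
      by simp
  qed
  with sets show ?L
    by (simp add: extendable_def)
qed

lemma ball_setcompr2: "(\<forall>H \<in> {g a b | a b. P a b}. Q H) \<longleftrightarrow> (\<forall>a b. P a b \<longrightarrow> Q (g a b))"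
  by blast

text \<open>
  The condition on the copy of $K_l$ given by \<open>f\<close> on \<open>S\<close> becomes the condition that exactly one
  tuple of \<open>T\<close> extends \<open>f\<close>. Uniqueness carries over because distinct tuples give distinct
  cliques.
\<close>

lemma decomposition_image_iff_extendable:
  assumes T: "T \<subseteq> tuples k n"
  shows "is_decomposition l k n (transversal_clique {1..k} ` T) \<longleftrightarrow> extendable l k n T"
proof -
  let ?C = "transversal_clique {1..k}"
  have inj: "inj_on ?C T"
    using inj_on_transversal_clique T by (rule inj_on_subset)
  have agree: "(\<exists>!K. K \<in> ?C ` T \<and> subgraph (with_proj (transversal_clique S f)) (with_proj K)) \<longleftrightarrow>
      (\<exists>!t. t \<in> T \<and> (\<forall>c \<in> S. t c = f c))" if "S \<subseteq> {1..k}" for S f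
  proof -
    have "(\<exists>!K. K \<in> ?C ` T \<and> subgraph (with_proj (transversal_clique S f)) (with_proj K)) \<longleftrightarrow>
        (\<exists>!t. t \<in> T \<and> subgraph (with_proj (transversal_clique S f)) (with_proj (?C t)))"
      using inj unfolding inj_on_def by blast
    then show ?thesis
      using that by (simp add: subgraph_transversal_clique)
  qed
  have "is_decomposition l k n (?C ` T) \<longleftrightarrow>
      (\<forall>H \<in> {transversal_clique S f | S f. S \<subseteq> {1..k} \<and> card S = l \<and> f \<in> S \<rightarrow>\<^sub>E {1..n}}.
        \<exists>!K. K \<in> ?C ` T \<and> subgraph (with_proj H) (with_proj K))"
    using image_mono[OF T, of ?C]
    by (simp add: is_decomposition_def clique_copies_full clique_copies_complete_partite[of l])
  also have "\<dots> \<longleftrightarrow>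
      (\<forall>S f. S \<subseteq> {1..k} \<and> card S = l \<and> f \<in> S \<rightarrow>\<^sub>E {1..n} \<longrightarrow>
        (\<exists>!K. K \<in> ?C ` T \<and> subgraph (with_proj (transversal_clique S f)) (with_proj K)))"
    by (rule ball_setcompr2)
  also have "\<dots> \<longleftrightarrow>
      (\<forall>S f. S \<subseteq> {1..k} \<and> card S = l \<and> f \<in> S \<rightarrow>\<^sub>E {1..n} \<longrightarrow>
        (\<exists>!t. t \<in> T \<and> (\<forall>c \<in> S. t c = f c)))"
    by (simp only: agree cong: conj_cong imp_cong)
  also have "\<dots> \<longleftrightarrow> extendable l k n T"
    using T by (simp only: extendable_iff_subsets imp_conjL simp_thms)
  finally show ?thesis .
qed

lemma ex_decomposition_iff_ex_extendable:
  "(\<exists>X. is_decomposition l k n X) \<longleftrightarrow> (\<exists>T. extendable l k n T)"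
proof
  assume "\<exists>X. is_decomposition l k n X"
  then obtain X where X: "is_decomposition l k n X" ..
  then have "X \<subseteq> transversal_clique {1..k} ` tuples k n"
    by (simp add: is_decomposition_def clique_copies_full)
  then obtain T where "T \<subseteq> tuples k n" "X = transversal_clique {1..k} ` T"
    by (auto simp: subset_image_iff)
  with X show "\<exists>T. extendable l k n T"
    using decomposition_image_iff_extendable by blast
next
  assume "\<exists>T. extendable l k n T"
  then obtain T where "extendable l k n T" ..
  moreover from this have "T \<subseteq> tuples k n"
    by (simp add: extendable_def)
  ultimately show "\<exists>X. is_decomposition l k n X"
    using decomposition_image_iff_extendable by blast
qed

section \<open>Extendable sets as graphs of Latin cubes\<close>

text \<open>
  The cubes are the first \<open>m\<close> coordinates of the unique tuple of \<open>T\<close> with given last \<open>l\<close>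
  entries. To reach a value \<open>v\<close> of the cube at position \<open>a\<close> by varying its argument \<open>i\<close>, prescribe
  \<open>v\<close> at \<open>a\<close> in place of an entry at \<open>m + i\<close>: these are again \<open>l\<close> positions, and the entry
  at \<open>m + i\<close> of the resulting tuple is the argument sought.
\<close>

lemma cubes_of_extendable:
  assumes ext: "extendable l (m + l) n T"
  obtains Ls where "length Ls = m" "\<forall>L \<in> set Ls. latin_cube l n L"
    "{graph_tuple l Ls x | x. x \<in> tuples l n} = T"
proof -
  have T: "T \<subseteq> tuples (m + l) n"
    using ext by (simp add: extendable_def)
  have ex1: "\<exists>!t. t \<in> T \<and> (\<forall>i \<in> {1..l}. t (m + i) = x i)" if "x \<in> tuples l n" for x
  proof -
    have "(\<lambda>i. m + i) \<in> {1..l} \<rightarrow> {1..m + l}" "strict_mono_on {1..l} (\<lambda>i. m + i)"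
      by (auto intro: strict_mono_onI)
    with ext that show ?thesis
      unfolding extendable_def by blast
  qed
  \<comment> \<open>The tuple of \<open>T\<close> that ends with \<open>x\<close>.\<close>
  define c where "c x = (THE t. t \<in> T \<and> (\<forall>i \<in> {1..l}. t (m + i) = x i))" for x
  have cT: "c x \<in> T" and c_tail: "\<And>i. i \<in> {1..l} \<Longrightarrow> c x (m + i) = x i"
    if "x \<in> tuples l n" for x
    using theI'[OF ex1[OF that]] by (auto simp: c_def)
  have c_eq: "c x = t" if "x \<in> tuples l n" "t \<in> T" "\<And>i. i \<in> {1..l} \<Longrightarrow> t (m + i) = x i" for x t
    unfolding c_def by (rule the1_equality[OF ex1[OF that(1)]]) (simp add: that)
  have c_tuple: "c x \<in> tuples (m + l) n" if "x \<in> tuples l n" for x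
    using cT[OF that] T by blast
  have c_range: "c x a \<in> {1..n}" if "x \<in> tuples l n" "a \<in> {1..m + l}" for x a
    using c_tuple[OF that(1)] that(2) unfolding tuples_def by (rule PiE_mem)
  define cube where "cube a = (\<lambda>x \<in> tuples l n. c x a)" for a
  define Ls where "Ls = map (\<lambda>a. cube (Suc a)) [0..<m]"
  have len: "length Ls = m"
    by (simp add: Ls_def)
  have graph: "graph_tuple l Ls x = c x" if x: "x \<in> tuples l n" for x
  proof (rule PiE_ext)
    show "c x \<in> {1..m + l} \<rightarrow>\<^sub>E {1..n}"
      using c_tuple[OF x] by (simp add: tuples_def)
    have entry: "graph_tuple l Ls x a = c x a" if a: "a \<in> {1..m + l}" for a
    proof (cases "a \<le> m")
      case True
      then show ?thesis
        using a x by (simp add: graph_tuple_def len Ls_def cube_def)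
    next
      case False
      then have "a - m \<in> {1..l}"
        using a by auto
      with False show ?thesis
        using a c_tail[OF x, of "a - m"] by (simp add: graph_tuple_def len)
    qed
    show "graph_tuple l Ls x \<in> {1..m + l} \<rightarrow>\<^sub>E {1..n}"
    proof
      show "graph_tuple l Ls x a \<in> {1..n}" if "a \<in> {1..m + l}" for a
        using entry c_range[OF x] that by metis
    qed (auto simp: graph_tuple_def len)
    show "graph_tuple l Ls x a = c x a" if "a \<in> {1..m + l}" for a
      using that by (rule entry)
  qed
  have "{graph_tuple l Ls x | x. x \<in> tuples l n} = T"
  proof (intro equalityI subsetI)
    fix t assume t: "t \<in> T"
    define x where "x = (\<lambda>i \<in> {1..l}. t (m + i))"
    have "t \<in> tuples (m + l) n"
      using t T by blast
    then have "x \<in> tuples l n"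
      by (auto simp: x_def tuples_def PiE_iff)
    moreover from this have "c x = t"
      using t by (rule c_eq) (simp add: x_def)
    ultimately show "t \<in> {graph_tuple l Ls x | x. x \<in> tuples l n}"
      using graph[of x] by (auto intro!: exI[of _ x])
  qed (use graph cT in auto)
  moreover have "latin_cube l n (cube a)" if a: "a \<in> {1..m}" for a
  proof -
    have "cube a \<in> tuples l n \<rightarrow>\<^sub>E {1..n}"
      unfolding cube_def restrict_PiE_iff using a c_range by simp
    moreover have "{cube a (x(i := j)) | j. j \<in> {1..n}} = {1..n}"
      if i: "i \<in> {1..l}" and x: "x \<in> ({1..l} - {i}) \<rightarrow>\<^sub>E {1..n}" for i x
    proof (intro equalityI subsetI)
      have upd: "x(i := j) \<in> tuples l n" if "j \<in> {1..n}" for j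
        using x i that by (auto simp: tuples_def PiE_iff extensional_def)
      show "v \<in> {1..n}" if "v \<in> {cube a (x(i := j)) | j. j \<in> {1..n}}" for v
      proof -
        from that obtain j where "j \<in> {1..n}" "v = cube a (x(i := j))"
          by blast
        then show ?thesis
          using upd c_range[of "x(i := j)" a] a by (simp add: cube_def)
      qed
      show "v \<in> {cube a (x(i := j)) | j. j \<in> {1..n}}" if v: "v \<in> {1..n}" for v
      proof -
        define S where "S = insert a ((\<lambda>i. m + i) ` ({1..l} - {i}))"
        define f where "f = (\<lambda>b \<in> S. if b = a then v else x (b - m))"
        have "S \<subseteq> {1..m + l}"
          using a by (auto simp: S_def)
        moreover have "card S = l"
        proof -
          have "a \<notin> (\<lambda>i. m + i) ` ({1..l} - {i})"
            using a by auto
          then have "card S = Suc (card ({1..l} - {i}))"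
            by (simp add: S_def card_image)
          then show ?thesis
            using i by simp
        qed
        moreover have "f \<in> S \<rightarrow>\<^sub>E {1..n}"
          using v x by (auto simp: f_def S_def PiE_iff)
        ultimately have "\<exists>!t. t \<in> T \<and> (\<forall>b \<in> S. t b = f b)"
          by (rule ext[unfolded extendable_iff_subsets, THEN conjunct2, rule_format])
        then obtain t where t: "t \<in> T" and tf: "\<And>b. b \<in> S \<Longrightarrow> t b = f b"
          by auto
        have "t \<in> tuples (m + l) n"
          using t T by blast
        then have j: "t (m + i) \<in> {1..n}"
          using i by (simp add: tuples_def PiE_iff)
        have "c (x(i := t (m + i))) = t"
        proof (rule c_eq[OF upd[OF j] t])
          show "t (m + i') = (x(i := t (m + i))) i'" if "i' \<in> {1..l}" for i'
            using that a tf[of "m + i'"] by (cases "i' = i") (auto simp: f_def S_def)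
        qed
        moreover have "t a = v"
          using tf[of a] by (simp add: f_def S_def)
        ultimately have "v = cube a (x(i := t (m + i)))"
          using upd[OF j] by (simp add: cube_def)
        with j show ?thesis
          by blast
      qed
    qed
    ultimately show ?thesis
      by (simp add: latin_cube_def)
  qed
  then have "\<forall>L \<in> set Ls. latin_cube l n L"
    by (auto simp: Ls_def)
  ultimately show thesis
    using len that by blast
qed

theorem theorem7:
  fixes k l n :: nat
  assumes "k \<ge> l" and "l \<ge> 1" and "n \<ge> 1"
  shows "(\<exists>X. is_decomposition l k n X) \<longleftrightarrow>
    (\<exists>Ls. length Ls = k - l \<and> (\<forall>L \<in> set Ls. latin_cube l n L) \<and> mutually_invertible l n Ls)"
proof -
  have k: "k - l + l = k"
    using assms(1) by simp
  have "(\<exists>T. extendable l k n T) \<longleftrightarrow>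
    (\<exists>Ls. length Ls = k - l \<and> (\<forall>L \<in> set Ls. latin_cube l n L) \<and> mutually_invertible l n Ls)"
  proof
    assume "\<exists>T. extendable l k n T"
    then obtain T where T: "extendable l (k - l + l) n T"
      by (auto simp: k)
    then obtain Ls where "length Ls = k - l" "\<forall>L \<in> set Ls. latin_cube l n L"
      "{graph_tuple l Ls x | x. x \<in> tuples l n} = T"
      by (rule cubes_of_extendable)
    with T show "\<exists>Ls. length Ls = k - l \<and> (\<forall>L \<in> set Ls. latin_cube l n L) \<and>
        mutually_invertible l n Ls"
      by (auto simp: mutually_invertible_def)
  next
    assume "\<exists>Ls. length Ls = k - l \<and> (\<forall>L \<in> set Ls. latin_cube l n L) \<and> mutually_invertible l n Ls"
    then show "\<exists>T. extendable l k n T"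
      by (auto simp: mutually_invertible_def k)
  qed
  then show ?thesis
    by (simp add: ex_decomposition_iff_ex_extendable)
qed

end
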